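(* Let $\mathcal{A}$ be a faithful Banach algebra with $\overline{\langle \mathcal{A}\cdot \mathcal{A}\rangle}= \mathcal{A}$. Then $\mathcal{A}_{M}$ is an ideal in its second dual if and only if $\mathcal{A}$ is an ideal in its second dual.
   Context: A Banach algebra $\mathcal{A}$ is faithful if for each $a\in\mathcal{A}\setminus\{0\}$ there are $b,c\in\mathcal{A}$ with $ab\neq 0$ and $ca\neq 0$. The multiplier norm on a faithful $\mathcal{A}$ is $\|a\|_M=\sup\{\|ab\|,\|ba\| : b\in\mathcal{A},\ \|b\|\le 1\}$, and $\mathcal{A}_M$ denotes the completion of $\mathcal{A}$ with respect to $\|\cdot\|_M$; it is a Banach algebra containing $\mathcal{A}$ as a dense two-sided ideal. $\overline{\langle\mathcal{A}\cdot\mathcal{A}\rangle}$ is the closed linear span in $\mathcal{A}$ of all products $ab$, $a,b\in\mathcal{A}$. For a Banach algebra $\mathcal{B}$, the left Arens product $\square$ on $\mathcal{B}^{**}$ is given by $\langle m\square n,f\rangle=\langle m,n\cdot f\rangle$, $\langle n\cdot f,a\rangle=\langle n,f\cdot a\rangle$, $\langle f\cdot a,b\rangle=\langle f,ab\rangle$ for $m,n\in\mathcal{B}^{**}$, $f\in\mathcal{B}^*$, $a,b\in\mathcal{B}$. "$\mathcal{B}$ is an ideal in its second dual" means that $\mathcal{B}$, canonically embedded, is a two-sided ideal in $(\mathcal{B}^{**},\square)$; equivalently, for each $a\in\mathcal{B}$ the operators $b\mapsto ab$ and $b\mapsto ba$ on $\mathcal{B}$ are weakly compact. *)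

theory Defs
  imports "HOL-Analysis.Analysis"
begin

section \<open>Complex Banach algebras\<close>

class scaleC =
  fixes scaleC :: "complex \<Rightarrow> 'a \<Rightarrow> 'a" (infixr \<open>*\<^sub>C\<close> 75)

class complex_normed_vector = real_normed_vector + scaleC +
  assumes scaleC_add_right: "c *\<^sub>C (x + y) = c *\<^sub>C x + c *\<^sub>C y"
    and scaleC_add_left: "(c + d) *\<^sub>C x = c *\<^sub>C x + d *\<^sub>C x"
    and scaleC_scaleC: "c *\<^sub>C d *\<^sub>C x = (c * d) *\<^sub>C x"
    and scaleC_one: "1 *\<^sub>C x = x"
    and scaleC_of_real: "complex_of_real r *\<^sub>C x = r *\<^sub>R x"
    and norm_scaleC: "norm (c *\<^sub>C x) = cmod c * norm x"

text \<open>No unit is required; \<^class>\<open>real_normed_algebra\<close> provides an associative bilinear product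
  with \<^term>\<open>norm (a * b) \<le> norm a * norm b\<close>, and \<^class>\<open>banach\<close> provides completeness.\<close>

class complex_banach_algebra = complex_normed_vector + real_normed_algebra + banach +
  assumes mult_scaleC_left: "(c *\<^sub>C a) * b = c *\<^sub>C (a * b)"
    and mult_scaleC_right: "a * (c *\<^sub>C b) = c *\<^sub>C (a * b)"

interpretation complex_vector:
  vector_space "scaleC :: complex \<Rightarrow> 'a \<Rightarrow> 'a::complex_normed_vector"
  by unfold_locales
    (simp_all add: scaleC_add_right scaleC_add_left scaleC_scaleC scaleC_one)

instantiation complex :: complex_banach_algebra
begin
definition scaleC_complex :: "complex \<Rightarrow> complex \<Rightarrow> complex"
  where "scaleC_complex c z = c * z"
instance
  by standard (simp_all add: scaleC_complex_def algebra_simps norm_mult scaleR_conv_of_real)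
end

definition bounded_clinear ::
    "('a::complex_normed_vector \<Rightarrow> 'b::complex_normed_vector) \<Rightarrow> bool"
  where "bounded_clinear f \<longleftrightarrow> Vector_Spaces.linear scaleC scaleC f \<and> bounded_linear f"

lemma bounded_clinearI:
  assumes "\<And>x y. f (x + y) = f x + f y" "\<And>c x. f (c *\<^sub>C x) = c *\<^sub>C f x"
    and "\<And>x. norm (f x) \<le> norm x * K"
  shows "bounded_clinear f"
  unfolding bounded_clinear_def
proof
  show "Vector_Spaces.linear scaleC scaleC f"
    using assms(1,2)
    by (simp add: linear_iff_module_hom module_hom_iff complex_vector.module_axioms)
  show "bounded_linear f"
    by (rule bounded_linear_intro[OF assms(1) _ assms(3)])
      (metis assms(2) scaleC_of_real)
qed

lemma bounded_clinear_scaleC: "bounded_clinear f \<Longrightarrow> f (c *\<^sub>C x) = c *\<^sub>C f x"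
  by (simp add: bounded_clinear_def linear_iff_module_hom module_hom_iff)

lemma bounded_clinear_imp_bounded_linear: "bounded_clinear f \<Longrightarrow> bounded_linear f"
  by (simp add: bounded_clinear_def)


section \<open>The dual space\<close>

typedef (overloaded) 'a cdual =
    "{f :: 'a::complex_normed_vector \<Rightarrow> complex. bounded_clinear f}"
  morphisms cdual_apply CDual
  by (rule exI[of _ "\<lambda>_. 0"]) (auto intro!: bounded_clinearI[where K = 0] simp: scaleC_complex_def)

setup_lifting type_definition_cdual

lemma bounded_clinear_cdual_apply: "bounded_clinear (cdual_apply f)"
  using cdual_apply[of f] by simp

lemmas bounded_linear_cdual_apply =
  bounded_clinear_imp_bounded_linear[OF bounded_clinear_cdual_apply]

lemma cdual_apply_add_right: "cdual_apply f (x + y) = cdual_apply f x + cdual_apply f y"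
  by (rule linear_add[OF bounded_linear.linear[OF bounded_linear_cdual_apply]])

lemma cdual_apply_scaleC_right: "cdual_apply f (c *\<^sub>C x) = c * cdual_apply f x"
  using bounded_clinear_scaleC[OF bounded_clinear_cdual_apply[of f]]
  by (simp add: scaleC_complex_def)

lemma cdual_eqI: "(\<And>x. cdual_apply f x = cdual_apply g x) \<Longrightarrow> f = g"
  by (simp add: cdual_apply_inject[symmetric] ext)

lemma cdual_apply_CDual: "bounded_clinear f \<Longrightarrow> cdual_apply (CDual f) x = f x"
  by (simp add: CDual_inverse)

lemma bounded_clinear_combine:
  assumes "bounded_clinear f" "bounded_clinear g"
  shows "bounded_clinear (\<lambda>x. c *\<^sub>C f x + d *\<^sub>C g x)"
proof -
  note bf = bounded_clinear_imp_bounded_linear[OF assms(1)]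
  note bg = bounded_clinear_imp_bounded_linear[OF assms(2)]
  obtain K where K: "\<And>x. norm (f x) \<le> norm x * K" using bounded_linear.bounded[OF bf] by blast
  obtain L where L: "\<And>x. norm (g x) \<le> norm x * L" using bounded_linear.bounded[OF bg] by blast
  show ?thesis
  proof (rule bounded_clinearI[where K = "cmod c * K + cmod d * L"])
    fix x y
    show "c *\<^sub>C f (x + y) + d *\<^sub>C g (x + y) =
        (c *\<^sub>C f x + d *\<^sub>C g x) + (c *\<^sub>C f y + d *\<^sub>C g y)"
      by (simp add: linear_add[OF bounded_linear.linear[OF bf]]
          linear_add[OF bounded_linear.linear[OF bg]] scaleC_add_right)
    show "c *\<^sub>C f (e *\<^sub>C x) + d *\<^sub>C g (e *\<^sub>C x) = e *\<^sub>C (c *\<^sub>C f x + d *\<^sub>C g x)" for e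
      by (simp add: bounded_clinear_scaleC[OF assms(1)] bounded_clinear_scaleC[OF assms(2)]
          scaleC_add_right scaleC_scaleC mult.commute)
    have "norm (c *\<^sub>C f x + d *\<^sub>C g x) \<le> cmod c * norm (f x) + cmod d * norm (g x)"
      by (rule norm_triangle_le) (simp add: norm_scaleC)
    also have "\<dots> \<le> cmod c * (norm x * K) + cmod d * (norm x * L)"
      by (intro add_mono mult_left_mono K L) auto
    finally show "norm (c *\<^sub>C f x + d *\<^sub>C g x) \<le> norm x * (cmod c * K + cmod d * L)"
      by (simp add: algebra_simps)
  qed
qed

instantiation cdual :: (complex_normed_vector) complex_normed_vector
begin

lift_definition zero_cdual :: "'a cdual" is "\<lambda>_. 0"
  by (auto intro!: bounded_clinearI[where K = 0] simp: scaleC_complex_def)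

lift_definition plus_cdual :: "'a cdual \<Rightarrow> 'a cdual \<Rightarrow> 'a cdual" is "\<lambda>f g x. f x + g x"
  using bounded_clinear_combine[where c = 1 and d = 1] by (simp add: scaleC_one)

lift_definition minus_cdual :: "'a cdual \<Rightarrow> 'a cdual \<Rightarrow> 'a cdual" is "\<lambda>f g x. f x - g x"
  using bounded_clinear_combine[where c = 1 and d = "-1"] by (simp add: scaleC_complex_def)

lift_definition uminus_cdual :: "'a cdual \<Rightarrow> 'a cdual" is "\<lambda>f x. - f x"
  using bounded_clinear_combine[where c = "-1" and d = 0] by (simp add: scaleC_complex_def)

lift_definition scaleR_cdual :: "real \<Rightarrow> 'a cdual \<Rightarrow> 'a cdual" is "\<lambda>r f x. r *\<^sub>R f x"
  subgoal for r f
    using bounded_clinear_combine[of f f "complex_of_real r" 0]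
    by (simp add: scaleC_complex_def scaleR_conv_of_real)
  done

lift_definition scaleC_cdual :: "complex \<Rightarrow> 'a cdual \<Rightarrow> 'a cdual" is "\<lambda>c f x. c * f x"
  subgoal for c f
    using bounded_clinear_combine[of f f c 0] by (simp add: scaleC_complex_def)
  done

definition norm_cdual :: "'a cdual \<Rightarrow> real"
  where "norm_cdual f = onorm (cdual_apply f)"

definition dist_cdual :: "'a cdual \<Rightarrow> 'a cdual \<Rightarrow> real"
  where "dist_cdual f g = norm (f - g)"

definition sgn_cdual :: "'a cdual \<Rightarrow> 'a cdual"
  where "sgn_cdual f = scaleR (inverse (norm f)) f"

definition uniformity_cdual :: "('a cdual \<times> 'a cdual) filter"
  where "uniformity_cdual = (INF e\<in>{0<..}. principal {(f, g). dist f g < e})"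

definition open_cdual :: "'a cdual set \<Rightarrow> bool"
  where "open_cdual U = (\<forall>f\<in>U. \<forall>\<^sub>F (f', g) in uniformity. f' = f \<longrightarrow> g \<in> U)"

instance
proof
  fix f g h :: "'a cdual" and r s :: real and c d :: complex
  show "f + g + h = f + (g + h)" "f + g = g + f" "0 + f = f" "- f + f = 0" "f - g = f + - g"
    "r *\<^sub>R (f + g) = r *\<^sub>R f + r *\<^sub>R g" "(r + s) *\<^sub>R f = r *\<^sub>R f + s *\<^sub>R f"
    "r *\<^sub>R s *\<^sub>R f = (r * s) *\<^sub>R f" "1 *\<^sub>R f = f"
    by (transfer; simp add: fun_eq_iff algebra_simps)+
  show "c *\<^sub>C (f + g) = c *\<^sub>C f + c *\<^sub>C g" "(c + d) *\<^sub>C f = c *\<^sub>C f + d *\<^sub>C f"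
    "c *\<^sub>C d *\<^sub>C f = (c * d) *\<^sub>C f" "1 *\<^sub>C f = f" "complex_of_real r *\<^sub>C f = r *\<^sub>R f"
    by (transfer; simp add: fun_eq_iff algebra_simps scaleR_conv_of_real)+
  show "dist f g = norm (f - g)" "sgn f = scaleR (inverse (norm f)) f"
    by (simp_all add: dist_cdual_def sgn_cdual_def)
  show "(uniformity :: ('a cdual \<times> 'a cdual) filter) = (INF e\<in>{0<..}. principal {(f, g). dist f g < e})"
    by (rule uniformity_cdual_def)
  show "open U \<longleftrightarrow> (\<forall>f\<in>U. \<forall>\<^sub>F (f', g) in uniformity. f' = f \<longrightarrow> g \<in> U)" for U :: "'a cdual set"
    by (rule open_cdual_def)
  show "norm f = 0 \<longleftrightarrow> f = 0"
    unfolding norm_cdual_def onorm_eq_0[OF bounded_linear_cdual_apply]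
    by (transfer; simp add: fun_eq_iff)
  show "norm (f + g) \<le> norm f + norm g"
    using onorm_triangle[OF bounded_linear_cdual_apply[of f] bounded_linear_cdual_apply[of g]]
    by (simp add: norm_cdual_def plus_cdual.rep_eq)
  show "norm (r *\<^sub>R f) = \<bar>r\<bar> * norm f"
    using onorm_scaleR[OF bounded_linear_cdual_apply[of f], of r]
    by (simp add: norm_cdual_def scaleR_cdual.rep_eq)
  have "onorm (\<lambda>x. c * cdual_apply f x) = cmod c * onorm (cdual_apply f)"
  proof -
    have "onorm (\<lambda>x. c * cdual_apply f x) = onorm (\<lambda>x. cmod c *\<^sub>R cdual_apply f x)"
      by (simp add: onorm_def norm_mult)
    then show ?thesis
      using onorm_scaleR[OF bounded_linear_cdual_apply[of f], of "cmod c"] by simp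
  qed
  then show "norm (c *\<^sub>C f) = cmod c * norm f"
    by (simp add: norm_cdual_def scaleC_cdual.rep_eq)
qed

end

lemma norm_cdual_apply_le: "cmod (cdual_apply f x) \<le> norm f * norm x"
  unfolding norm_cdual_def by (rule onorm[OF bounded_linear_cdual_apply])

lemma norm_cdual_leI: "0 \<le> K \<Longrightarrow> (\<And>x. cmod (cdual_apply f x) \<le> K * norm x) \<Longrightarrow> norm f \<le> K"
  unfolding norm_cdual_def by (rule onorm_bound)


section \<open>Arens product on the second dual\<close>

type_synonym 'a cbidual = "'a cdual cdual"

definition canonical_embedding :: "'a::complex_normed_vector \<Rightarrow> 'a cbidual"
  where "canonical_embedding a = CDual (\<lambda>f. cdual_apply f a)"

definition dual_act :: "'a::complex_banach_algebra cdual \<Rightarrow> 'a \<Rightarrow> 'a cdual"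
  where "dual_act f a = CDual (\<lambda>b. cdual_apply f (a * b))"

definition bidual_act :: "'a::complex_banach_algebra cbidual \<Rightarrow> 'a cdual \<Rightarrow> 'a cdual"
  where "bidual_act n f = CDual (\<lambda>a. cdual_apply n (dual_act f a))"

definition arens :: "'a::complex_banach_algebra cbidual \<Rightarrow> 'a cbidual \<Rightarrow> 'a cbidual"
    (infixl \<open>\<box>\<close> 70)
  where "m \<box> n = CDual (\<lambda>f. cdual_apply m (bidual_act n f))"

text \<open>Each argument of \<^const>\<open>CDual\<close> above is bounded and complex linear:\<close>

lemma canonical_embedding_apply: "cdual_apply (canonical_embedding a) f = cdual_apply f a"
  unfolding canonical_embedding_def
proof (rule cdual_apply_CDual, rule bounded_clinearI)
  show "cmod (cdual_apply f a) \<le> norm f * norm a" for f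
    by (rule norm_cdual_apply_le)
qed (simp_all add: plus_cdual.rep_eq scaleC_cdual.rep_eq scaleC_complex_def)

lemma dual_act_apply: "cdual_apply (dual_act f a) b = cdual_apply f (a * b)"
  unfolding dual_act_def
proof (rule cdual_apply_CDual, rule bounded_clinearI)
  fix b
  have "cmod (cdual_apply f (a * b)) \<le> norm f * norm (a * b)"
    by (rule norm_cdual_apply_le)
  also have "\<dots> \<le> norm f * (norm a * norm b)"
    by (intro mult_left_mono norm_mult_ineq) auto
  finally show "cmod (cdual_apply f (a * b)) \<le> norm b * (norm f * norm a)"
    by (simp add: algebra_simps)
qed (simp_all add: distrib_left cdual_apply_add_right mult_scaleC_right cdual_apply_scaleC_right
    scaleC_complex_def)

lemma norm_dual_act_le: "norm (dual_act f a) \<le> norm f * norm a"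
proof (rule norm_cdual_leI)
  fix b
  have "cmod (cdual_apply f (a * b)) \<le> norm f * norm (a * b)"
    by (rule norm_cdual_apply_le)
  also have "\<dots> \<le> norm f * (norm a * norm b)"
    by (intro mult_left_mono norm_mult_ineq) auto
  finally show "cmod (cdual_apply (dual_act f a) b) \<le> norm f * norm a * norm b"
    by (simp add: algebra_simps dual_act_apply)
qed simp

lemma dual_act_linear:
  "dual_act (f + g) a = dual_act f a + dual_act g a"
  "dual_act f (a + b) = dual_act f a + dual_act f b"
  "dual_act (c *\<^sub>C f) a = c *\<^sub>C dual_act f a"
  "dual_act f (c *\<^sub>C a) = c *\<^sub>C dual_act f a"
  by (auto intro!: cdual_eqI simp: dual_act_apply plus_cdual.rep_eq scaleC_cdual.rep_eq
      distrib_right cdual_apply_add_right mult_scaleC_left cdual_apply_scaleC_right)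

lemma cmod_bidual_act_le: "cmod (cdual_apply n (dual_act f a)) \<le> norm n * norm f * norm a"
proof -
  have "cmod (cdual_apply n (dual_act f a)) \<le> norm n * norm (dual_act f a)"
    by (rule norm_cdual_apply_le)
  also have "\<dots> \<le> norm n * (norm f * norm a)"
    by (intro mult_left_mono norm_dual_act_le) auto
  finally show ?thesis by (simp add: algebra_simps)
qed

lemma bidual_act_apply: "cdual_apply (bidual_act n f) a = cdual_apply n (dual_act f a)"
  unfolding bidual_act_def
proof (rule cdual_apply_CDual, rule bounded_clinearI)
  show "cmod (cdual_apply n (dual_act f a)) \<le> norm a * (norm n * norm f)" for a
    using cmod_bidual_act_le[of n f a] by (simp add: algebra_simps)
qed (simp_all add: dual_act_linear cdual_apply_add_right cdual_apply_scaleC_right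
    scaleC_complex_def)

lemma norm_bidual_act_le: "norm (bidual_act n f) \<le> norm n * norm f"
  by (rule norm_cdual_leI) (simp_all add: bidual_act_apply cmod_bidual_act_le)

lemma bidual_act_linear:
  "bidual_act n (f + g) = bidual_act n f + bidual_act n g"
  "bidual_act n (c *\<^sub>C f) = c *\<^sub>C bidual_act n f"
  by (auto intro!: cdual_eqI simp: bidual_act_apply plus_cdual.rep_eq scaleC_cdual.rep_eq
      dual_act_linear cdual_apply_add_right cdual_apply_scaleC_right)

lemma arens_apply: "cdual_apply (m \<box> n) f = cdual_apply m (bidual_act n f)"
  unfolding arens_def
proof (rule cdual_apply_CDual, rule bounded_clinearI)
  fix f
  have "cmod (cdual_apply m (bidual_act n f)) \<le> norm m * norm (bidual_act n f)"
    by (rule norm_cdual_apply_le)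
  also have "\<dots> \<le> norm m * (norm n * norm f)"
    by (intro mult_left_mono norm_bidual_act_le) auto
  finally show "cmod (cdual_apply m (bidual_act n f)) \<le> norm f * (norm m * norm n)"
    by (simp add: algebra_simps)
qed (simp_all add: bidual_act_linear cdual_apply_add_right cdual_apply_scaleC_right
    scaleC_complex_def)

definition two_sided_ideal ::
    "('v::complex_normed_vector \<Rightarrow> 'v \<Rightarrow> 'v) \<Rightarrow> 'v set \<Rightarrow> bool"
  where "two_sided_ideal mul I \<longleftrightarrow>
    module.subspace scaleC I \<and> (\<forall>m. \<forall>x\<in>I. mul m x \<in> I \<and> mul x m \<in> I)"

definition ideal_in_second_dual :: "'a::complex_banach_algebra itself \<Rightarrow> bool"
  where "ideal_in_second_dual _ \<longleftrightarrow>
    two_sided_ideal (\<box>) (range (canonical_embedding :: 'a \<Rightarrow> 'a cbidual))"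


section \<open>Faithfulness and the multiplier norm\<close>

definition faithful_algebra :: "'a::complex_banach_algebra itself \<Rightarrow> bool"
  where "faithful_algebra _ \<longleftrightarrow>
    (\<forall>a::'a. a \<noteq> 0 \<longrightarrow> (\<exists>b c. a * b \<noteq> 0 \<and> c * a \<noteq> 0))"

definition closed_span_products :: "'a::complex_banach_algebra set"
  where "closed_span_products = closure (module.span scaleC {a * b | a b. True})"

definition multiplier_norm :: "'a::complex_banach_algebra \<Rightarrow> real"
  where "multiplier_norm a =
    Sup ({norm (a * b) | b. norm b \<le> 1} \<union> {norm (b * a) | b. norm b \<le> 1})"

text \<open>A Banach algebra \<^typ>\<open>'b\<close> together with \<^term>\<open>\<iota> :: 'a \<Rightarrow> 'b\<close> is a completion of \<^typ>\<open>'a\<close> for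
  the multiplier norm. Completeness is part of the class of \<^typ>\<open>'b\<close>; such a completion is unique
  up to a unique isometric isomorphism of Banach algebras compatible with \<^term>\<open>\<iota>\<close>.\<close>

definition multiplier_completion ::
    "('a::complex_banach_algebra \<Rightarrow> 'b::complex_banach_algebra) \<Rightarrow> bool"
  where "multiplier_completion \<iota> \<longleftrightarrow>
    Vector_Spaces.linear scaleC scaleC \<iota> \<and>
    (\<forall>a b. \<iota> (a * b) = \<iota> a * \<iota> b) \<and>
    (\<forall>a. norm (\<iota> a) = multiplier_norm a) \<and>
    closure (range \<iota>) = UNIV"

end

theory Submission
  imports Defs
begin

text \<open>
  Let \<open>L\<^sub>a\<close> and \<open>R\<^sub>a\<close> denote left and right multiplication by \<open>a\<close>. Since \<open>a \<box> n = L\<^sub>a\<^sup>*\<^sup>* n\<close> and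
  \<open>n \<box> a = R\<^sub>a\<^sup>*\<^sup>* n\<close>, an algebra is an ideal in its second dual iff all second adjoints of
  multiplications take values in the canonical image. Operators with this property form an
  operator ideal, and by Hahn--Banach they are closed in operator norm, so it suffices to treat
  multiplications by products \<open>x y\<close> of elements of \<open>A\<close>. As \<open>\<parallel>x a\<parallel> \<le> \<parallel>x\<parallel> \<parallel>a\<parallel>\<^sub>M\<close>, left multiplication by
  \<open>x\<close> extends to a bounded map from \<open>A\<^sub>M\<close> to \<open>A\<close>. Thus \<open>L\<^bsub>xy\<^esub>\<close> on \<open>A\<close> is the composition of the
  inclusion \<open>\<iota>\<close>, \<open>L\<^sub>y\<close> on \<open>A\<^sub>M\<close> and the extended \<open>L\<^sub>x\<close>, while \<open>L\<^bsub>xy\<^esub>\<close> on \<open>A\<^sub>M\<close> is the composition of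
  the extended \<open>L\<^sub>y\<close>, \<open>L\<^sub>x\<close> on \<open>A\<close> and \<open>\<iota>\<close>; right multiplications are analogous.
\<close>

section \<open>Norming functionals\<close>

definition sublinear :: "('a::real_vector \<Rightarrow> real) \<Rightarrow> bool"
  where "sublinear p \<longleftrightarrow> (\<forall>x y. p (x + y) \<le> p x + p y) \<and> (\<forall>r x. 0 \<le> r \<longrightarrow> p (r *\<^sub>R x) = r * p x)"

lemma sublinear_add: "sublinear p \<Longrightarrow> p (x + y) \<le> p x + p y"
  and sublinear_scaleR: "sublinear p \<Longrightarrow> 0 \<le> r \<Longrightarrow> p (r *\<^sub>R x) = r * p x"
  by (auto simp: sublinear_def)

lemma sublinear_zero: "sublinear p \<Longrightarrow> p 0 = 0"
  using sublinear_scaleR[of p 0 0] by simp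

lemma sublinear_minus: "sublinear p \<Longrightarrow> - p (- x) \<le> p x"
  using sublinear_add[of p x "- x"] sublinear_zero[of p] by simp

lemma sublinear_norm: "sublinear (norm :: 'a::real_normed_vector \<Rightarrow> real)"
  by (simp add: sublinear_def norm_triangle_ineq)

text \<open>For sublinear \<open>p\<close> this lies below \<open>p\<close> (take
  \<open>t = 0\<close>) and is at most \<open>- p a\<close> at \<open>- a\<close> (take
  \<open>t = 1\<close>), so every linear functional below it agrees with \<open>p\<close> at
  \<open>a\<close>.\<close>

definition lower_along :: "'a::real_vector \<Rightarrow> ('a \<Rightarrow> real) \<Rightarrow> 'a \<Rightarrow> real"
  where "lower_along a p x = (INF t\<in>{0..}. p (x + t *\<^sub>R a) - t * p a)"

lemma lower_along_le:
  assumes p: "sublinear p" and t: "0 \<le> t"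
  shows "lower_along a p x \<le> p (x + t *\<^sub>R a) - t * p a"
  unfolding lower_along_def
proof (rule cINF_lower)
  \<comment> \<open>A real infimum is informative only on a set bounded below; subadditivity
    provides a bound independent of \<open>s\<close>.\<close>
  have "- p (- x) \<le> p (x + s *\<^sub>R a) - s * p a" if "0 \<le> s" for s
    using sublinear_add[OF p, of "x + s *\<^sub>R a" "- x"] sublinear_scaleR[OF p that, of a] by simp
  then show "bdd_below ((\<lambda>t. p (x + t *\<^sub>R a) - t * p a) ` {0..})"
    by (intro bdd_belowI2[where m = "- p (- x)"]) auto
qed (use t in simp)

lemma lower_along_greatest:
  "(\<And>t. 0 \<le> t \<Longrightarrow> l \<le> p (x + t *\<^sub>R a) - t * p a) \<Longrightarrow> l \<le> lower_along a p x"
  unfolding lower_along_def by (rule cINF_greatest) auto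

text \<open>Subadditivity: parameters \<open>s\<close> for \<open>x\<close> and \<open>t\<close> for
  \<open>y\<close> combine to \<open>s + t\<close> for \<open>x + y\<close>, and the infima are
  taken one after the other. Homogeneity: rescaling \<open>t\<close> to \<open>r * t\<close> gives
  one inequality, and that inequality for \<open>inverse r\<close> gives the other.\<close>

lemma sublinear_lower_along:
  assumes p: "sublinear p"
  shows "sublinear (lower_along a p)"
  unfolding sublinear_def
proof (intro conjI allI impI)
  fix x y
  have step: "lower_along a p (x + y) \<le> (p (x + s *\<^sub>R a) - s * p a) + (p (y + t *\<^sub>R a) - t * p a)"
    if "0 \<le> s" "0 \<le> t" for s t
    using lower_along_le[OF p, of "s + t" a "x + y"] that
      sublinear_add[OF p, of "x + s *\<^sub>R a" "y + t *\<^sub>R a"]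
    by (simp add: algebra_simps)
  have "lower_along a p (x + y) - (p (y + t *\<^sub>R a) - t * p a) \<le> lower_along a p x"
    if "0 \<le> t" for t
    using step[OF _ that] by (intro lower_along_greatest) (simp add: algebra_simps)
  then have "lower_along a p (x + y) - lower_along a p x \<le> lower_along a p y"
    by (intro lower_along_greatest) (simp add: algebra_simps)
  then show "lower_along a p (x + y) \<le> lower_along a p x + lower_along a p y"
    by simp
next
  have le: "lower_along a p (r *\<^sub>R x) \<le> r * lower_along a p x" if r: "0 < r" for r x
  proof -
    have "lower_along a p (r *\<^sub>R x) / r \<le> lower_along a p x"
    proof (rule lower_along_greatest)
      fix t :: real assume "0 \<le> t"
      then have "lower_along a p (r *\<^sub>R x) \<le> p (r *\<^sub>R (x + t *\<^sub>R a)) - (r * t) * p a"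
        using lower_along_le[OF p, of "r * t" a "r *\<^sub>R x"] r
        by (simp add: scaleR_add_right mult.commute)
      then have "lower_along a p (r *\<^sub>R x) \<le> r * p (x + t *\<^sub>R a) - (r * t) * p a"
        using sublinear_scaleR[OF p, of r "x + t *\<^sub>R a"] r by simp
      then show "lower_along a p (r *\<^sub>R x) / r \<le> p (x + t *\<^sub>R a) - t * p a"
        using r by (simp add: field_simps)
    qed
    then show ?thesis using r by (simp add: field_simps)
  qed
  fix r :: real and x assume "0 \<le> r"
  show "lower_along a p (r *\<^sub>R x) = r * lower_along a p x"
  proof (cases "r = 0")
    case True
    have "lower_along a p 0 = 0"
    proof (rule antisym)
      show "lower_along a p 0 \<le> 0"
        using lower_along_le[OF p, of 0 a 0] sublinear_zero[OF p] by simp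
      show "0 \<le> lower_along a p 0"
        by (rule lower_along_greatest) (simp add: sublinear_scaleR[OF p])
    qed
    then show ?thesis using True by simp
  next
    case False
    then have r: "0 < r" using \<open>0 \<le> r\<close> by simp
    have "lower_along a p x \<le> inverse r * lower_along a p (r *\<^sub>R x)"
      using le[of "inverse r" "r *\<^sub>R x"] r by simp
    then have "r * lower_along a p x \<le> lower_along a p (r *\<^sub>R x)"
      using r by (simp add: field_simps)
    then show ?thesis using le[OF r, of x] by simp
  qed
qed

text \<open>Minimality forces \<^term>\<open>lower_along a p = p\<close>, and the value \<open>t = 1\<close> in the infimum then gives
  \<^prop>\<open>p x + p a \<le> p (x + a)\<close>.\<close>

lemma minimal_sublinear_imp_linear:
  assumes p: "sublinear p" and min: "\<And>q. sublinear q \<Longrightarrow> q \<le> p \<Longrightarrow> q = p"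
  shows "linear p"
proof (rule linearI)
  have add: "p (x + a) = p x + p a" for x a
  proof -
    have "lower_along a p \<le> p"
      using lower_along_le[OF p, of 0 a] by (auto intro: le_funI)
    then have "lower_along a p = p"
      by (rule min[OF sublinear_lower_along[OF p]])
    then have "p x \<le> p (x + a) - p a"
      using lower_along_le[OF p, of 1 a x] by simp
    then show ?thesis using sublinear_add[OF p, of x a] by simp
  qed
  have neg: "p (- x) = - p x" for x
    using add[of x "- x"] sublinear_zero[OF p] by simp
  show "p (x + a) = p x + p a" for x a by (rule add)
  show "p (r *\<^sub>R x) = r *\<^sub>R p x" for r x
  proof (cases "0 \<le> r")
    case True
    then show ?thesis by (simp add: sublinear_scaleR[OF p])
  next
    case False
    then have "p (r *\<^sub>R x) = p (- ((- r) *\<^sub>R x))" by simp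
    also have "\<dots> = r * p x"
      using False by (simp only: neg) (simp add: sublinear_scaleR[OF p] del: scaleR_minus_left)
    finally show ?thesis by simp
  qed
qed

text \<open>Infima of sublinear functionals need not be subadditive. In a chain, two members
  \<open>p\<close> and \<open>q\<close> dominate a common member \<open>m\<close>, so
  \<open>p x + q y\<close> dominates \<open>m (x + y)\<close>.\<close>

lemma sublinear_INF_chain:
  fixes C :: "('a::real_vector \<Rightarrow> real) set"
  assumes C: "C \<noteq> {}" and sub: "\<And>p. p \<in> C \<Longrightarrow> sublinear p"
    and bdd: "\<And>x. bdd_below ((\<lambda>p. p x) ` C)"
    and chain: "\<And>p q. p \<in> C \<Longrightarrow> q \<in> C \<Longrightarrow> p \<le> q \<or> q \<le> p"
  shows "sublinear (\<lambda>x. INF p\<in>C. p x)"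
proof -
  define u where "u x = (INF p\<in>C. p x)" for x
  have low: "u x \<le> p x" if "p \<in> C" for p x
    unfolding u_def by (rule cINF_lower[OF bdd that])
  have great: "l \<le> u x" if "\<And>p. p \<in> C \<Longrightarrow> l \<le> p x" for l x
    unfolding u_def using that by (rule cINF_greatest[OF C])
  have "u (x + y) \<le> u x + u y" for x y
  proof -
    have step: "u (x + y) \<le> p x + q y" if pq: "p \<in> C" "q \<in> C" for p q
    proof -
      obtain m where m: "m \<in> C" "m \<le> p" "m \<le> q" using chain[OF pq] pq by blast
      have "u (x + y) \<le> m x + m y"
        using low[OF m(1), of "x + y"] sublinear_add[OF sub[OF m(1)], of x y] by linarith
      then show ?thesis using le_funD[OF m(2), of x] le_funD[OF m(3), of y] by linarith
    qed
    have "u (x + y) - q y \<le> u x" if "q \<in> C" for q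
      using step[OF _ that] by (intro great) (simp add: algebra_simps)
    then have "u (x + y) - u x \<le> u y"
      by (intro great) (simp add: algebra_simps)
    then show ?thesis by simp
  qed
  moreover have "u (r *\<^sub>R x) = r * u x" if r: "0 \<le> r" for r x
  proof -
    have "u (r *\<^sub>R x) = (INF p\<in>C. r * p x)"
      unfolding u_def by (rule INF_cong) (auto simp: sublinear_scaleR[OF sub r])
    also have "\<dots> = r * u x"
    proof (cases "r = 0")
      case True
      then show ?thesis using C by simp
    next
      case False
      then have r0: "0 < r" using r by simp
      show ?thesis
      proof (rule antisym)
        have "(INF p\<in>C. r * p x) / r \<le> u x"
        proof (rule great)
          fix p assume "p \<in> C"
          then have "(INF p\<in>C. r * p x) \<le> r * p x"
            using low[of _ x] r by (intro cINF_lower bdd_belowI2[where m = "r * u x"] mult_left_mono)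
          then show "(INF p\<in>C. r * p x) / r \<le> p x" using r0 by (simp add: field_simps)
        qed
        then show "(INF p\<in>C. r * p x) \<le> r * u x" using r0 by (simp add: field_simps)
        show "r * u x \<le> (INF p\<in>C. r * p x)"
          using C low[of _ x] r by (intro cINF_greatest mult_left_mono) auto
      qed
    qed
    finally show ?thesis .
  qed
  ultimately show ?thesis by (simp add: sublinear_def flip: u_def)
qed

text \<open>Zorn's lemma for the reversed order on the sublinear functionals below \<open>p\<close>:
  a nonempty chain is bounded by its pointwise infimum, and a minimal element is linear.\<close>

lemma linear_below_sublinear:
  fixes p :: "'a::real_vector \<Rightarrow> real"
  assumes p: "sublinear p"
  shows "\<exists>f. linear f \<and> f \<le> p"
proof -
  define P where "P = {q. sublinear q \<and> q \<le> p}"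
  have bdd: "bdd_below ((\<lambda>q. q x) ` C)" if "C \<subseteq> P" for C x
  proof (rule bdd_belowI2)
    fix q assume "q \<in> C"
    then have q: "sublinear q" "q \<le> p" using that by (auto simp: P_def)
    show "- p (- x) \<le> q x"
      using sublinear_minus[OF q(1), of x] le_funD[OF q(2), of "- x"] by linarith
  qed
  have "\<exists>m\<in>P. \<forall>q\<in>P. m \<ge> q \<longrightarrow> q = m"
  proof (rule predicate_Zorn)
    show "partial_order_on P (relation_of (\<ge>) P)"
      by (rule partial_order_on_relation_ofI) auto
    fix C assume "C \<in> Chains (relation_of (\<ge>) P)"
    then have C: "C \<subseteq> P" and chain: "\<And>q q'. q \<in> C \<Longrightarrow> q' \<in> C \<Longrightarrow> q \<le> q' \<or> q' \<le> q"
      by (auto simp: Chains_def relation_of_def)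
    show "\<exists>u\<in>P. \<forall>q\<in>C. q \<ge> u"
    proof (cases "C = {}")
      case True
      then show ?thesis using p by (auto simp: P_def)
    next
      case False
      define u where "u x = (INF q\<in>C. q x)" for x
      have low: "u \<le> q" if "q \<in> C" for q
        unfolding u_def using that by (intro le_funI cINF_lower bdd[OF C])
      have "sublinear u"
        unfolding u_def
        by (rule sublinear_INF_chain[OF False _ bdd[OF C] chain]) (use C in \<open>auto simp: P_def\<close>)
      moreover obtain q where "q \<in> C" using False by blast
      then have "u \<le> p" using low[of q] C by (auto simp: P_def)
      ultimately show ?thesis using low by (auto simp: P_def)
    qed
  qed
  then obtain f where f: "f \<in> P" "\<And>q. q \<in> P \<Longrightarrow> q \<le> f \<Longrightarrow> q = f" by blast
  have "linear f"
  proof (rule minimal_sublinear_imp_linear)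
    show "sublinear f" using f(1) by (simp add: P_def)
    show "q = f" if "sublinear q" "q \<le> f" for q
      using that f by (auto simp: P_def intro: order_trans)
  qed
  then show ?thesis using f(1) by (auto simp: P_def)
qed

text \<open>Starting from \<open>lower_along x norm\<close> instead of \<open>norm\<close> forces
  the value at \<open>x\<close>.\<close>

lemma ex_norming_linear:
  fixes x :: "'a::real_normed_vector"
  shows "\<exists>f. linear f \<and> (\<forall>y. \<bar>f y\<bar> \<le> norm y) \<and> f x = norm x"
proof -
  let ?p = "lower_along x norm"
  obtain f where f: "linear f" "f \<le> ?p"
    using linear_below_sublinear[OF sublinear_lower_along[OF sublinear_norm]] by blast
  have le: "f y \<le> norm y" for y
    using lower_along_le[OF sublinear_norm, of 0 x y] le_funD[OF f(2), of y] by simp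
  have neg: "f (- y) = - f y" for y by (rule linear_neg[OF f(1)])
  have "f (- x) \<le> - norm x"
    using lower_along_le[OF sublinear_norm, of 1 x "- x"] le_funD[OF f(2), of "- x"] by simp
  then have "f x = norm x" using le[of x] by (simp add: neg)
  moreover have "\<bar>f y\<bar> \<le> norm y" for y
    using le[of y] le[of "- y"] by (simp add: neg abs_le_iff)
  ultimately show ?thesis using f(1) by blast
qed

section \<open>From real to complex functionals\<close>

lemma scaleC_scaleR_commute: "c *\<^sub>C r *\<^sub>R x = r *\<^sub>R c *\<^sub>C (x :: 'a::complex_normed_vector)"
  by (simp add: scaleC_scaleC mult.commute flip: scaleC_of_real)

lemma ex_norming_cdual:
  fixes x :: "'a::complex_normed_vector"
  shows "\<exists>f. norm f \<le> 1 \<and> norm x \<le> cmod (cdual_apply f x)"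
proof -
  obtain f where f: "linear f" "\<And>y. \<bar>f y\<bar> \<le> norm y" "f x = norm x"
    using ex_norming_linear[of x] by blast
  \<comment> \<open>The complex linear functional whose real part is \<open>f\<close>.\<close>
  define g where "g y = Complex (f y) (- f (\<i> *\<^sub>C y))" for y
  have g_add: "g (y + z) = g y + g z" for y z
    by (simp add: g_def linear_add[OF f(1)] scaleC_add_right complex_eq_iff)
  have g_scale: "g (c *\<^sub>C y) = c * g y" for c y
  proof -
    have "c *\<^sub>C y = Re c *\<^sub>R y + Im c *\<^sub>R \<i> *\<^sub>C y"
      by (metis complex_eq mult.commute scaleC_add_left scaleC_of_real scaleC_scaleC)
    moreover from this have "\<i> *\<^sub>C c *\<^sub>C y = Re c *\<^sub>R \<i> *\<^sub>C y - Im c *\<^sub>R y"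
      by (simp add: scaleC_add_right scaleC_scaleR_commute scaleC_scaleC
          scaleC_of_real[of "-1", simplified])
    ultimately show ?thesis
      by (simp add: g_def complex_eq_iff linear_add[OF f(1)] linear_diff[OF f(1)]
          linear_scale[OF f(1)])
  qed
  have g_le: "cmod (g y) \<le> norm y" for y
  proof (cases "g y = 0")
    case False
    \<comment> \<open>Multiplication by the unimodular \<open>u\<close> rotates \<open>g y\<close>
      onto the positive real axis, where the bound on the real part \<open>f\<close> bounds the
      modulus.\<close>
    define u where "u = cnj (g y) / cmod (g y)"
    have "u * g y = cmod (g y)"
      using False by (simp add: u_def complex_norm_square[symmetric] mult.commute power2_eq_square)
    then have "cmod (g y) = Re (g (u *\<^sub>C y))" by (simp add: g_scale)
    also have "\<dots> \<le> norm (u *\<^sub>C y)"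
      using f(2)[of "u *\<^sub>C y"] by (simp add: g_def)
    also have "\<dots> = norm y"
      using False by (simp add: norm_scaleC u_def norm_divide)
    finally show ?thesis .
  qed simp
  have "bounded_clinear g"
    by (rule bounded_clinearI[where K = 1]) (simp_all add: g_add g_scale g_le scaleC_complex_def)
  then have app: "cdual_apply (CDual g) y = g y" for y by (rule cdual_apply_CDual)
  have "norm x \<le> cmod (g x)"
    using complex_Re_le_cmod[of "g x"] f(3) by (simp add: g_def)
  moreover have "norm (CDual g) \<le> 1"
    by (rule norm_cdual_leI) (simp_all add: app g_le)
  ultimately show ?thesis by (metis app)
qed

section \<open>Bounded complex linear maps and the canonical embedding\<close>

lemma bounded_clinear_add: "bounded_clinear f \<Longrightarrow> f (x + y) = f x + f y"
  by (simp add: linear_add bounded_linear.linear bounded_clinear_imp_bounded_linear)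

lemma bounded_clinear_zero: "bounded_clinear f \<Longrightarrow> f 0 = 0"
  by (simp add: linear_0 bounded_linear.linear bounded_clinear_imp_bounded_linear)

lemma bounded_clinear_comp:
  assumes "bounded_clinear f" "bounded_clinear g"
  shows "bounded_clinear (\<lambda>x. f (g x))"
  using assms bounded_linear_compose[of f g]
  by (simp add: bounded_clinear_def linear_iff_module_hom module_hom_iff)

lemma bounded_clinear_canonical_embedding: "bounded_clinear canonical_embedding"
proof (rule bounded_clinearI[where K = 1])
  show "norm (canonical_embedding x) \<le> norm x * 1" for x :: 'a
    using norm_cdual_apply_le[of _ x]
    by (intro norm_cdual_leI) (simp_all add: canonical_embedding_apply mult.commute)
qed (auto intro!: cdual_eqI simp: canonical_embedding_apply plus_cdual.rep_eq scaleC_cdual.rep_eq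
    cdual_apply_add_right cdual_apply_scaleC_right)

text \<open>The one place where norming functionals enter; the embedding becomes isometric, which
  makes the range of a Banach space closed.\<close>

lemma norm_canonical_embedding_ge: "norm x \<le> norm (canonical_embedding x)"
proof -
  obtain f where f: "norm f \<le> 1" "norm x \<le> cmod (cdual_apply f x)"
    using ex_norming_cdual[of x] by blast
  have "cmod (cdual_apply f x) \<le> norm (canonical_embedding x) * norm f"
    using norm_cdual_apply_le[of "canonical_embedding x" f] by (simp add: canonical_embedding_apply)
  also have "\<dots> \<le> norm (canonical_embedding x)"
    using f(1) by (simp add: mult_left_le)
  finally show ?thesis using f(2) by simp
qed

lemma subspace_range_canonical_embedding:
  "module.subspace scaleC (range canonical_embedding)"
proof (rule complex_vector.subspaceI)
  show "0 \<in> range canonical_embedding"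
    using bounded_clinear_zero[OF bounded_clinear_canonical_embedding] by (metis rangeI)
qed (auto simp flip: bounded_clinear_add[OF bounded_clinear_canonical_embedding]
    bounded_clinear_scaleC[OF bounded_clinear_canonical_embedding])

lemma closed_range_canonical_embedding:
  "closed (range (canonical_embedding :: 'a::{complex_normed_vector,banach} \<Rightarrow> _))"
proof (rule complete_imp_closed, rule complete_isometric_image[where e = 1])
  show "complete (UNIV :: 'a set)" by (simp add: complete_UNIV)
qed (simp_all add: norm_canonical_embedding_ge
    bounded_clinear_imp_bounded_linear[OF bounded_clinear_canonical_embedding])


section \<open>Weakly compact operators\<close>

definition dual_map :: "('a::complex_normed_vector \<Rightarrow> 'b::complex_normed_vector) \<Rightarrow> 'b cdual \<Rightarrow> 'a cdual"
  where "dual_map T f = CDual (\<lambda>x. cdual_apply f (T x))"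

lemma dual_map_apply:
  "bounded_clinear T \<Longrightarrow> cdual_apply (dual_map T f) x = cdual_apply f (T x)"
  unfolding dual_map_def
  by (rule cdual_apply_CDual) (rule bounded_clinear_comp[OF bounded_clinear_cdual_apply])

lemma norm_dual_map_le:
  assumes T: "bounded_clinear T" and K: "0 \<le> K" "\<And>x. norm (T x) \<le> K * norm x"
  shows "norm (dual_map T f) \<le> K * norm f"
proof (rule norm_cdual_leI)
  fix x
  have "cmod (cdual_apply f (T x)) \<le> norm f * norm (T x)" by (rule norm_cdual_apply_le)
  also have "\<dots> \<le> norm f * (K * norm x)" by (intro mult_left_mono K) simp
  finally show "cmod (cdual_apply (dual_map T f) x) \<le> K * norm f * norm x"
    by (simp add: dual_map_apply[OF T] mult_ac)
qed (simp add: K)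

lemma bounded_clinear_dual_map:
  assumes T: "bounded_clinear T"
  shows "bounded_clinear (dual_map T)"
proof -
  obtain K where K: "0 \<le> K" "\<And>x. norm (T x) \<le> norm x * K"
    using bounded_linear.nonneg_bounded[OF bounded_clinear_imp_bounded_linear[OF T]] by blast
  show ?thesis
  proof (rule bounded_clinearI)
    show "norm (dual_map T f) \<le> norm f * K" for f
      using norm_dual_map_le[OF T K(1), of f] K(2) by (simp add: mult.commute)
  qed (auto intro!: cdual_eqI
      simp: dual_map_apply[OF T] plus_cdual.rep_eq scaleC_cdual.rep_eq)
qed

lemma dual_map_comp:
  assumes "bounded_clinear S" "bounded_clinear T"
  shows "dual_map (\<lambda>x. S (T x)) = (\<lambda>f. dual_map T (dual_map S f))"
  using assms by (auto intro!: ext cdual_eqI simp: dual_map_apply bounded_clinear_comp)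

lemma bidual_map_canonical_embedding:
  "bounded_clinear T \<Longrightarrow>
    dual_map (dual_map T) (canonical_embedding x) = canonical_embedding (T x)"
  by (rule cdual_eqI)
    (simp add: dual_map_apply bounded_clinear_dual_map canonical_embedding_apply)

text \<open>By Gantmacher's theorem this is weak compactness of \<open>T\<close>; the condition on the second
  adjoint is the only form of weak compactness that the argument needs.\<close>

definition weakly_compact_map ::
    "('a::complex_normed_vector \<Rightarrow> 'b::complex_normed_vector) \<Rightarrow> bool"
  where "weakly_compact_map T \<longleftrightarrow>
    bounded_clinear T \<and> (\<forall>n. dual_map (dual_map T) n \<in> range canonical_embedding)"

text \<open>The second adjoint of \<open>T\<close> lands in the canonical image, and that of
  \<open>S\<close> extends \<open>S\<close>, so it sends \<open>canonical_embedding y\<close> to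
  \<open>canonical_embedding (S y)\<close>.\<close>

lemma weakly_compact_map_comp_left:
  assumes S: "bounded_clinear S" and T: "weakly_compact_map T"
  shows "weakly_compact_map (\<lambda>x. S (T x))"
proof -
  have T': "bounded_clinear T" using T by (simp add: weakly_compact_map_def)
  have "dual_map (dual_map (\<lambda>x. S (T x))) n \<in> range canonical_embedding" for n
  proof -
    obtain y where "dual_map (dual_map T) n = canonical_embedding y"
      using T by (force simp: weakly_compact_map_def)
    then show ?thesis
      by (simp add: dual_map_comp S T' bounded_clinear_dual_map bidual_map_canonical_embedding)
  qed
  then show ?thesis by (auto simp: weakly_compact_map_def bounded_clinear_comp[OF S T'])
qed

text \<open>Precomposition only changes the bidual element at which the second adjoint of
  \<open>S\<close> is evaluated.\<close>

lemma weakly_compact_map_comp_right: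
  assumes S: "weakly_compact_map S" and T: "bounded_clinear T"
  shows "weakly_compact_map (\<lambda>x. S (T x))"
  using S T unfolding weakly_compact_map_def
  by (auto simp: dual_map_comp bounded_clinear_dual_map bounded_clinear_comp)

section \<open>Operator families depending linearly on a parameter\<close>

locale bounded_cbilinear =
  fixes \<Phi> :: "'c::complex_normed_vector \<Rightarrow> 'a::complex_normed_vector \<Rightarrow> 'b::{complex_normed_vector,banach}"
  assumes add_left: "\<Phi> (c + d) x = \<Phi> c x + \<Phi> d x"
    and scaleC_left: "\<Phi> (r *\<^sub>C c) x = r *\<^sub>C \<Phi> c x"
    and add_right: "\<Phi> c (x + y) = \<Phi> c x + \<Phi> c y"
    and scaleC_right: "\<Phi> c (r *\<^sub>C x) = r *\<^sub>C \<Phi> c x"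
    and norm_le: "norm (\<Phi> c x) \<le> norm c * norm x"
begin

lemma bounded_clinear_right: "bounded_clinear (\<Phi> c)"
  by (rule bounded_clinearI[where K = "norm c"])
    (simp_all add: add_right scaleC_right norm_le mult.commute[of "norm _" "norm c"])

text \<open>With \<open>n\<close> fixed and the operator varying, weak compactness of
  \<open>\<Phi> c\<close> becomes a membership condition on a vector depending continuously and
  linearly on \<open>c\<close>.\<close>

lemma bounded_clinear_bidual_map: "bounded_clinear (\<lambda>c. dual_map (dual_map (\<Phi> c)) n)"
proof (rule bounded_clinearI)
  note [simp] = dual_map_apply bounded_clinear_right bounded_clinear_dual_map
    plus_cdual.rep_eq scaleC_cdual.rep_eq
  have "dual_map (\<Phi> (c + d)) f = dual_map (\<Phi> c) f + dual_map (\<Phi> d) f" for c d f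
    by (rule cdual_eqI) (simp add: add_left cdual_apply_add_right)
  then show "dual_map (dual_map (\<Phi> (c + d))) n =
      dual_map (dual_map (\<Phi> c)) n + dual_map (dual_map (\<Phi> d)) n" for c d
    by (intro cdual_eqI) (simp add: cdual_apply_add_right)
  have "dual_map (\<Phi> (r *\<^sub>C c)) f = r *\<^sub>C dual_map (\<Phi> c) f" for r c f
    by (rule cdual_eqI) (simp add: scaleC_left cdual_apply_scaleC_right)
  then show "dual_map (dual_map (\<Phi> (r *\<^sub>C c))) n = r *\<^sub>C dual_map (dual_map (\<Phi> c)) n" for r c
    by (intro cdual_eqI) (simp add: cdual_apply_scaleC_right)
  show "norm (dual_map (dual_map (\<Phi> c)) n) \<le> norm c * norm n" for c
    by (intro norm_dual_map_le bounded_clinear_dual_map bounded_clinear_right norm_le norm_ge_zero)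
qed

lemma weakly_compact_eq_INT:
  "{c. weakly_compact_map (\<Phi> c)} =
    (\<Inter>n. (\<lambda>c. dual_map (dual_map (\<Phi> c)) n) -` range canonical_embedding)"
  by (auto simp: weakly_compact_map_def bounded_clinear_right)

text \<open>An intersection of preimages of the closed canonical range under continuous maps; this
  is the norm closedness of weakly compact operators, read off on the parameters.\<close>

lemma closed_weakly_compact: "closed {c. weakly_compact_map (\<Phi> c)}"
  unfolding weakly_compact_eq_INT
  by (intro closed_INT ballI closed_vimage closed_range_canonical_embedding linear_continuous_on
      bounded_clinear_imp_bounded_linear bounded_clinear_bidual_map)

lemma subspace_weakly_compact: "module.subspace scaleC {c. weakly_compact_map (\<Phi> c)}"
proof (rule complex_vector.subspaceI)
  note clin = bounded_clinear_bidual_map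
    and sub = subspace_range_canonical_embedding[where 'a = 'b]
  show "0 \<in> {c. weakly_compact_map (\<Phi> c)}"
    by (simp add: weakly_compact_eq_INT bounded_clinear_zero[OF clin] complex_vector.subspace_0[OF sub])
  show "c + d \<in> {c. weakly_compact_map (\<Phi> c)}"
    if "c \<in> {c. weakly_compact_map (\<Phi> c)}" "d \<in> {c. weakly_compact_map (\<Phi> c)}" for c d
    using that unfolding weakly_compact_eq_INT
    by (simp add: bounded_clinear_add[OF clin] complex_vector.subspace_add[OF sub])
  show "r *\<^sub>C c \<in> {c. weakly_compact_map (\<Phi> c)}" if "c \<in> {c. weakly_compact_map (\<Phi> c)}" for r c
    using that unfolding weakly_compact_eq_INT
    by (simp add: bounded_clinear_scaleC[OF clin] complex_vector.subspace_scale[OF sub])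
qed

lemma weakly_compact_if_dense:
  assumes "closure (range \<iota>) = UNIV" "\<And>a. weakly_compact_map (\<Phi> (\<iota> a))"
  shows "weakly_compact_map (\<Phi> c)"
proof -
  have "closure (range \<iota>) \<subseteq> {c. weakly_compact_map (\<Phi> c)}"
    using assms(2) by (intro closure_minimal closed_weakly_compact) auto
  then show ?thesis using assms(1) by auto
qed

end

text \<open>The good parameters form a closed subspace; containing all products, it contains their
  closed span.\<close>

lemma weakly_compact_if_products:
  fixes \<Phi> :: "'c::complex_banach_algebra \<Rightarrow> _"
  assumes "bounded_cbilinear \<Phi>" and dense: "(closed_span_products :: 'c set) = UNIV"
    and "\<And>x y. weakly_compact_map (\<Phi> (x * y))"
  shows "weakly_compact_map (\<Phi> c)"
proof -
  interpret bounded_cbilinear \<Phi> by fact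
  have "module.span scaleC {x * y | x y. True} \<subseteq> {c. weakly_compact_map (\<Phi> c)}"
    using assms(3) by (intro complex_vector.span_minimal subspace_weakly_compact) auto
  then have "(closed_span_products :: 'c set) \<subseteq> {c. weakly_compact_map (\<Phi> c)}"
    unfolding closed_span_products_def by (intro closure_minimal closed_weakly_compact)
  then show ?thesis using dense by auto
qed

text \<open>\<open>T b\<close> is the limit of \<open>S\<close> along a sequence whose image under
  \<open>\<iota>\<close> tends to \<open>b\<close>. Bounding \<open>S a\<close> by
  \<open>norm (\<iota> a)\<close> carries Cauchy sequences over and makes the limit independent of
  the sequence.\<close>

lemma bounded_clinear_extension:
  fixes \<iota> :: "'a::complex_normed_vector \<Rightarrow> 'b::complex_normed_vector"
    and S :: "'a \<Rightarrow> 'c::{complex_normed_vector,banach}"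
  assumes \<iota>: "bounded_clinear \<iota>" and S: "bounded_clinear S"
    and dense: "closure (range \<iota>) = UNIV" and K: "\<And>a. norm (S a) \<le> norm (\<iota> a) * K"
  shows "\<exists>T. bounded_clinear T \<and> (\<forall>a. T (\<iota> a) = S a)"
proof -
  note \<iota>_diff = linear_diff[OF bounded_linear.linear[OF bounded_clinear_imp_bounded_linear[OF \<iota>]]]
    and S_diff = linear_diff[OF bounded_linear.linear[OF bounded_clinear_imp_bounded_linear[OF S]]]
  have "\<exists>s. (\<lambda>n. \<iota> (s n)) \<longlonglongrightarrow> b" for b
  proof -
    have "b \<in> closure (range \<iota>)" using dense by simp
    then obtain y where y: "\<And>n. y n \<in> range \<iota>" "y \<longlonglongrightarrow> b"
      by (auto simp: closure_sequential)
    then have "\<iota> (inv \<iota> (y n)) = y n" for n by (simp add: f_inv_into_f)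
    then show ?thesis using y(2) by (intro exI[of _ "\<lambda>n. inv \<iota> (y n)"]) simp
  qed
  then obtain s where s: "\<And>b. (\<lambda>n. \<iota> (s b n)) \<longlonglongrightarrow> b" by metis
  define T where "T b = lim (\<lambda>n. S (s b n))" for b
  have "convergent (\<lambda>n. S (s b n))" for b
  proof -
    have "Cauchy (\<lambda>n. \<iota> (s b n))" using s by (blast intro: LIMSEQ_imp_Cauchy)
    \<comment> \<open>\<open>K\<close> may be zero or negative; \<open>L\<close> is positive, so
      \<open>e / L\<close> is a valid tolerance.\<close>
    moreover define L where "L = \<bar>K\<bar> + 1"
    have L: "0 < L" "norm (S a) \<le> norm (\<iota> a) * L" for a
    proof -
      have "norm (\<iota> a) * K \<le> norm (\<iota> a) * L" by (rule mult_left_mono) (auto simp: L_def)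
      then show "norm (S a) \<le> norm (\<iota> a) * L" using K[of a] by simp
    qed (simp add: L_def)
    ultimately have "Cauchy (\<lambda>n. S (s b n))"
      unfolding Cauchy_iff
    proof (intro allI impI)
      fix e :: real
      assume "0 < e" and C: "\<forall>e>0. \<exists>M. \<forall>m\<ge>M. \<forall>n\<ge>M. norm (\<iota> (s b m) - \<iota> (s b n)) < e"
      then obtain M where M: "\<And>m n. m \<ge> M \<Longrightarrow> n \<ge> M \<Longrightarrow> norm (\<iota> (s b m) - \<iota> (s b n)) < e / L"
        using L(1) by (meson divide_pos_pos)
      have "norm (S (s b m) - S (s b n)) < e" if "m \<ge> M" "n \<ge> M" for m n
        using L(2)[of "s b m - s b n"] M[OF that] L(1)
        by (simp add: \<iota>_diff S_diff pos_less_divide_eq)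
      then show "\<exists>M. \<forall>m\<ge>M. \<forall>n\<ge>M. norm (S (s b m) - S (s b n)) < e" by blast
    qed
    then show ?thesis by (simp add: Cauchy_convergent_iff)
  qed
  then have sT: "(\<lambda>n. S (s b n)) \<longlonglongrightarrow> T b" for b
    by (simp add: T_def convergent_LIMSEQ_iff)
  \<comment> \<open>Independence of the approximating sequence; it reduces linearity of
    \<open>T\<close> to uniqueness of limits.\<close>
  have lim: "(\<lambda>n. S (a n)) \<longlonglongrightarrow> T b" if a: "(\<lambda>n. \<iota> (a n)) \<longlonglongrightarrow> b" for a b
  proof -
    have "(\<lambda>n. \<iota> (a n - s b n)) \<longlonglongrightarrow> 0"
      using tendsto_diff[OF a s[of b]] by (simp add: \<iota>_diff)
    then have "(\<lambda>n. S (a n - s b n)) \<longlonglongrightarrow> 0"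
      by (rule tendsto_0_le[where K = K]) (simp add: K)
    then show ?thesis using tendsto_add[OF _ sT[of b]] by (fastforce simp: S_diff)
  qed
  have "T (x + y) = T x + T y" for x y
  proof (rule LIMSEQ_unique)
    show "(\<lambda>n. S (s x n + s y n)) \<longlonglongrightarrow> T (x + y)"
      using tendsto_add[OF s[of x] s[of y]] by (intro lim) (simp add: bounded_clinear_add[OF \<iota>])
    show "(\<lambda>n. S (s x n + s y n)) \<longlonglongrightarrow> T x + T y"
      using tendsto_add[OF sT[of x] sT[of y]] by (simp add: bounded_clinear_add[OF S])
  qed
  moreover have "T (c *\<^sub>C x) = c *\<^sub>C T x" for c x
  proof (rule LIMSEQ_unique)
    \<comment> \<open>The type is left open because this is applied both in the source and in the
      target of \<open>T\<close>.\<close>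
    have cont: "(\<lambda>n. c *\<^sub>C u n) \<longlonglongrightarrow> c *\<^sub>C l" if "u \<longlonglongrightarrow> l"
      for u :: "nat \<Rightarrow> 'd::complex_normed_vector" and l
    proof (rule bounded_linear.tendsto[OF bounded_clinear_imp_bounded_linear that])
      show "bounded_clinear (\<lambda>v :: 'd. c *\<^sub>C v)"
        by (rule bounded_clinearI[where K = "cmod c"])
          (simp_all add: scaleC_add_right scaleC_scaleC norm_scaleC mult.commute)
    qed
    show "(\<lambda>n. S (c *\<^sub>C s x n)) \<longlonglongrightarrow> T (c *\<^sub>C x)"
      using cont[OF s[of x]] by (intro lim) (simp add: bounded_clinear_scaleC[OF \<iota>])
    show "(\<lambda>n. S (c *\<^sub>C s x n)) \<longlonglongrightarrow> c *\<^sub>C T x"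
      using cont[OF sT[of x]] by (simp add: bounded_clinear_scaleC[OF S])
  qed
  moreover have "norm (T x) \<le> norm x * K" for x
  proof (rule LIMSEQ_le)
    show "(\<lambda>n. norm (S (s x n))) \<longlonglongrightarrow> norm (T x)" by (intro tendsto_norm sT)
    show "(\<lambda>n. norm (\<iota> (s x n)) * K) \<longlonglongrightarrow> norm x * K"
      by (intro tendsto_mult tendsto_norm s tendsto_const)
  qed (auto intro: K)
  ultimately have "bounded_clinear T" by (rule bounded_clinearI)
  moreover have "T (\<iota> a) = S a" for a
    using lim[of "\<lambda>_. a" "\<iota> a"] by (simp add: LIMSEQ_const_iff)
  ultimately show ?thesis by blast
qed


section \<open>Ideals in the second dual\<close>

lemma bounded_cbilinear_mult: "bounded_cbilinear ((*) :: 'a \<Rightarrow> 'a \<Rightarrow> 'a::complex_banach_algebra)"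
  by unfold_locales (simp_all add: algebra_simps mult_scaleC_left mult_scaleC_right norm_mult_ineq)

lemma bounded_cbilinear_mult_right: "bounded_cbilinear (\<lambda>a b. b * a :: 'a::complex_banach_algebra)"
  by unfold_locales
    (simp_all add: algebra_simps mult_scaleC_left mult_scaleC_right,
      metis mult.commute norm_mult_ineq)

lemmas bounded_clinear_mult = bounded_cbilinear.bounded_clinear_right[OF bounded_cbilinear_mult]
  and bounded_clinear_mult_right =
    bounded_cbilinear.bounded_clinear_right[OF bounded_cbilinear_mult_right]

text \<open>Lets multiplications by \<open>\<iota> a\<close> on the completion be indexed by the
  algebra itself, whose products span densely.\<close>

lemma bounded_cbilinear_comp:
  assumes "bounded_cbilinear \<Phi>" "bounded_clinear \<iota>" "\<And>a. norm (\<iota> a) \<le> norm a"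
  shows "bounded_cbilinear (\<lambda>a. \<Phi> (\<iota> a))"
proof -
  interpret bounded_cbilinear \<Phi> by fact
  show ?thesis
  proof
    show "norm (\<Phi> (\<iota> a) x) \<le> norm a * norm x" for a x
      using norm_le[of "\<iota> a" x] mult_right_mono[OF assms(3)[of a], of "norm x"] by simp
  qed (simp_all add: add_left scaleC_left add_right scaleC_right
      bounded_clinear_add[OF assms(2)] bounded_clinear_scaleC[OF assms(2)])
qed

text \<open>The adjoint of left multiplication is \<open>dual_act\<close>; that of right
  multiplication is \<open>bidual_act\<close> at the canonical image of \<open>a\<close>.\<close>

lemma arens_canonical_embedding:
  "canonical_embedding a \<box> n = dual_map (dual_map ((*) a)) n"
  "n \<box> canonical_embedding a = dual_map (dual_map (\<lambda>b. b * a)) n"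
proof -
  have "dual_map ((*) a) f = dual_act f a" for f
    by (rule cdual_eqI) (simp add: dual_map_apply bounded_clinear_mult dual_act_apply)
  then show "canonical_embedding a \<box> n = dual_map (dual_map ((*) a)) n"
    by (intro cdual_eqI) (simp add: arens_apply canonical_embedding_apply bidual_act_apply
        dual_map_apply bounded_clinear_dual_map bounded_clinear_mult)
  have "dual_map (\<lambda>b. b * a) f = bidual_act (canonical_embedding a) f" for f
    by (rule cdual_eqI) (simp add: dual_map_apply bounded_clinear_mult_right bidual_act_apply
        canonical_embedding_apply dual_act_apply)
  then show "n \<box> canonical_embedding a = dual_map (dual_map (\<lambda>b. b * a)) n"
    by (intro cdual_eqI) (simp add: arens_apply dual_map_apply bounded_clinear_dual_map
        bounded_clinear_mult_right)
qed

lemma ideal_in_second_dual_iff: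
  "ideal_in_second_dual TYPE('a::complex_banach_algebra) \<longleftrightarrow>
    (\<forall>a::'a. weakly_compact_map ((*) a) \<and> weakly_compact_map (\<lambda>b. b * a))"
  using subspace_range_canonical_embedding[where 'a = 'a]
  by (auto simp: ideal_in_second_dual_def two_sided_ideal_def weakly_compact_map_def
      arens_canonical_embedding bounded_clinear_mult bounded_clinear_mult_right)

section \<open>Estimates for the multiplier norm\<close>

lemma norm_le_multiplier_norm:
  fixes a :: "'a::complex_banach_algebra"
  shows "norm (a * b) \<le> multiplier_norm a * norm b" "norm (b * a) \<le> multiplier_norm a * norm b"
    and multiplier_norm_le: "multiplier_norm a \<le> norm a"
proof -
  let ?X = "{norm (a * b) | b. norm b \<le> 1} \<union> {norm (b * a) | b. norm b \<le> 1}"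
  have bd: "x \<le> norm a" if x_in: "x \<in> ?X" for x
  proof -
    obtain b :: 'a where "norm b \<le> 1" and x: "x = norm (a * b) \<or> x = norm (b * a)"
      using x_in by blast
    then have "norm a * norm b \<le> norm a" by (simp add: mult_left_le)
    then show ?thesis
      using x norm_mult_ineq[of a b] norm_mult_ineq[of b a] by (auto simp: mult.commute)
  qed
  then have bdd: "bdd_above ?X" by (rule bdd_aboveI)
  \<comment> \<open>The witness 0 makes the set nonempty, as the upper bound on its supremum
    requires.\<close>
  have "norm (a * 0) \<in> ?X" by (intro UnI1 CollectI exI[of _ 0]) simp
  then show "multiplier_norm a \<le> norm a"
    unfolding multiplier_norm_def using bd by (intro cSup_least) blast+
  have "norm (a * b) \<le> multiplier_norm a * norm b \<and> norm (b * a) \<le> multiplier_norm a * norm b"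
  proof (cases "b = 0")
    case False
    let ?b = "inverse (norm b) *\<^sub>R b"
    have "norm ?b \<le> 1" using False by simp
    then have "norm (a * ?b) \<in> ?X" "norm (?b * a) \<in> ?X" by blast+
    then have "norm (a * ?b) \<le> multiplier_norm a" "norm (?b * a) \<le> multiplier_norm a"
      unfolding multiplier_norm_def by (auto intro: cSup_upper[OF _ bdd])
    then show ?thesis using False by (simp add: field_simps)
  qed simp
  then show "norm (a * b) \<le> multiplier_norm a * norm b" "norm (b * a) \<le> multiplier_norm a * norm b"
    by auto
qed

theorem proposition3p10:
  fixes \<iota> :: "'a::complex_banach_algebra \<Rightarrow> 'b::complex_banach_algebra"
  assumes "faithful_algebra TYPE('a)"
    and "(closed_span_products :: 'a set) = UNIV"
    and "multiplier_completion \<iota>"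
  shows "ideal_in_second_dual TYPE('b) \<longleftrightarrow> ideal_in_second_dual TYPE('a)"
proof -
  have \<iota>_mult: "\<iota> (a * b) = \<iota> a * \<iota> b" and norm_\<iota>: "norm (\<iota> a) = multiplier_norm a"
    and dense: "closure (range \<iota>) = UNIV" for a b
    using assms(3) by (auto simp: multiplier_completion_def)
  have norm_\<iota>_le: "norm (\<iota> a) \<le> norm a" for a
    by (simp add: norm_\<iota> multiplier_norm_le)
  have \<iota>: "bounded_clinear \<iota>"
    using assms(3) norm_\<iota>_le
    by (intro bounded_clinearI[where K = 1])
      (auto simp: multiplier_completion_def linear_iff_module_hom module_hom_iff)
  \<comment> \<open>Operator identities on the completion need checking only on the dense image of
    \<open>\<iota>\<close>.\<close>
  have cont_eq: "f = g" if "bounded_clinear f" "bounded_clinear g" "\<And>a. f (\<iota> a) = g (\<iota> a)"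
    for f g :: "'b \<Rightarrow> 'b"
  proof -
    have "closed {b. f b = g b}"
      by (intro closed_Collect_eq linear_continuous_on bounded_clinear_imp_bounded_linear that(1,2))
    then have "closure (range \<iota>) \<subseteq> {b. f b = g b}"
      using that(3) by (intro closure_minimal) auto
    then show ?thesis using dense by auto
  qed

  \<comment> \<open>\<open>l x\<close> and \<open>r x\<close> are the maps \<open>b \<mapsto> x b\<close> and \<open>b \<mapsto> b x\<close> from the completion into the
    algebra, which is an ideal of it.\<close>
  have "\<exists>T. bounded_clinear T \<and> (\<forall>a. T (\<iota> a) = x * a)" for x
    using norm_le_multiplier_norm(2)[where b = x]
    by (intro bounded_clinear_extension[OF \<iota> bounded_clinear_mult dense]) (simp add: norm_\<iota>)
  then obtain l where l: "\<And>x. bounded_clinear (l x)" "\<And>x a. l x (\<iota> a) = x * a" by metis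
  have "\<exists>T. bounded_clinear T \<and> (\<forall>a. T (\<iota> a) = a * x)" for x
    using norm_le_multiplier_norm(1)[where b = x]
    by (intro bounded_clinear_extension[OF \<iota> bounded_clinear_mult_right dense]) (simp add: norm_\<iota>)
  then obtain r where r: "\<And>x. bounded_clinear (r x)" "\<And>x a. r x (\<iota> a) = a * x" by metis

  show ?thesis
    unfolding ideal_in_second_dual_iff
  proof (intro iffI allI conjI)
    assume wc: "\<forall>b::'b. weakly_compact_map ((*) b) \<and> weakly_compact_map (\<lambda>c. c * b)"
    have "weakly_compact_map ((*) (x * y))" for x y :: 'a
    proof -
      have "weakly_compact_map (\<lambda>a. l x (\<iota> y * \<iota> a))"
        using wc by (intro weakly_compact_map_comp_left[OF l(1)]
            weakly_compact_map_comp_right[OF _ \<iota>]) simp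
      moreover have "(\<lambda>a. l x (\<iota> y * \<iota> a)) = (*) (x * y)"
        by (simp add: fun_eq_iff l(2) mult.assoc flip: \<iota>_mult)
      ultimately show ?thesis by simp
    qed
    then show "weakly_compact_map ((*) a)" for a :: 'a
      by (rule weakly_compact_if_products[OF bounded_cbilinear_mult assms(2)])
    \<comment> \<open>The order is reversed on this side: \<open>x\<close> acts first, in the
      completion, and \<open>r y\<close> then returns to the algebra.\<close>
    have "weakly_compact_map (\<lambda>a. a * (x * y))" for x y :: 'a
    proof -
      have "weakly_compact_map (\<lambda>a. r y (\<iota> a * \<iota> x))"
        using wc by (intro weakly_compact_map_comp_left[OF r(1)]
            weakly_compact_map_comp_right[OF _ \<iota>]) simp
      then show ?thesis by (simp add: r(2) mult.assoc flip: \<iota>_mult)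
    qed
    then show "weakly_compact_map (\<lambda>b. b * a)" for a :: 'a
      by (rule weakly_compact_if_products[OF bounded_cbilinear_mult_right assms(2)])
  next
    assume wc: "\<forall>a::'a. weakly_compact_map ((*) a) \<and> weakly_compact_map (\<lambda>b. b * a)"
    have "weakly_compact_map ((*) (\<iota> (x * y)))" for x y
    proof -
      have "(\<lambda>b. \<iota> (x * l y b)) = (*) (\<iota> (x * y))"
        by (rule cont_eq)
          (simp_all add: l bounded_clinear_mult bounded_clinear_comp[OF \<iota>]
            bounded_clinear_comp[OF bounded_clinear_mult] \<iota>_mult mult.assoc)
      moreover have "weakly_compact_map (\<lambda>b. \<iota> (x * l y b))"
        using wc by (intro weakly_compact_map_comp_left[OF \<iota>]
            weakly_compact_map_comp_right[OF _ l(1)]) simp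
      ultimately show ?thesis by simp
    qed
    \<comment> \<open>Two density arguments in succession: first the products in the algebra, then
      the range of \<open>\<iota>\<close> in the completion.\<close>
    then have "weakly_compact_map ((*) (\<iota> a))" for a
      by (rule weakly_compact_if_products[OF
            bounded_cbilinear_comp[OF bounded_cbilinear_mult \<iota> norm_\<iota>_le] assms(2)])
    then show "weakly_compact_map ((*) b)" for b :: 'b
      by (rule bounded_cbilinear.weakly_compact_if_dense[OF bounded_cbilinear_mult dense])
    \<comment> \<open>Here \<open>r x\<close> leads into the algebra, where right multiplication by
      \<open>y\<close> is the weakly compact factor.\<close>
    have "weakly_compact_map (\<lambda>b. b * \<iota> (x * y))" for x y
    proof -
      have "(\<lambda>b. \<iota> (r x b * y)) = (\<lambda>b. b * \<iota> (x * y))"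
        by (rule cont_eq)
          (simp_all add: r bounded_clinear_mult_right bounded_clinear_comp[OF \<iota>]
            bounded_clinear_comp[OF bounded_clinear_mult_right] \<iota>_mult mult.assoc)
      moreover have "weakly_compact_map (\<lambda>b. \<iota> (r x b * y))"
        using wc by (intro weakly_compact_map_comp_left[OF \<iota>]
            weakly_compact_map_comp_right[where S = "\<lambda>b. b * y", OF _ r(1)]) simp
      ultimately show ?thesis by simp
    qed
    then have "weakly_compact_map (\<lambda>b. b * \<iota> a)" for a
      by (rule weakly_compact_if_products[OF
            bounded_cbilinear_comp[OF bounded_cbilinear_mult_right \<iota> norm_\<iota>_le] assms(2)])
    then show "weakly_compact_map (\<lambda>c. c * b)" for b :: 'b
      by (rule bounded_cbilinear.weakly_compact_if_dense[OF bounded_cbilinear_mult_right dense])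
  qed
qed

end
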